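(* Let $\mathcal{S}\subseteq L^2(X)$ be a Hilbert space containing the dictionary $\mathcal{D}=\{g_\lambda:\lambda\in\Lambda\}$, and suppose that its greedy factor $\beta=\beta(\mathcal{S},\mathcal{D})>0$, where $\beta^2=\inf_{u\in\mathcal{S},\,\|u\|=1}\ \sup_{\lambda\in\Lambda}\langle g_\lambda,u\rangle^2$, is non-zero. Suppose that $\mathcal{D}$ has non-zero condition number $\mathcal{K}^{-1}$ (i.e. $\mathcal{K}<\infty$). Let $\Lambda_{\rm d}\subset\Lambda$ be a countable set covering $\Lambda$ with density radius $\rho_{\rm d}=\sup_{\lambda\in\Lambda}\inf_{k\in\Lambda_{\rm d}}d_{\mathcal{G}}(\lambda,k)$, and assume $\rho_{\rm d}<\beta/\sqrt{1+\mathcal{K}}$. Let $\alpha\in(0,1]$ and set $$\alpha'=\alpha\,\big(1-\beta^{-2}\rho_{\rm d}^2(1+\mathcal{K})\big)^{1/2}\ \leq\ \alpha .$$ Then, for functions in $\mathcal{S}$, the discrete weak matching pursuit dMP$(\alpha)$ over $\mathcal{D}_{\rm d}=\{g_k:k\in\Lambda_{\rm d}\}$ is bounded by the exponential convergence rate of the continuous weak matching pursuit cMP$(\alpha')$ over $\mathcal{D}$; that is, for every $f\in\mathcal{S}$, every sequence of residuals $(R^mf)_{m\ge 0}$ produced by dMP$(\alpha)$ satisfies $$\|R^{m}f\|\ \le\ (1-\alpha'^2\beta^2)^{m/2}\,\|f\|\qquad\text{for all } m\ge 0 .$$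
   Context: Setting. $X$ is a measure space and $L^2(X)$ is the real Hilbert space of square-integrable real functions, with scalar product $\langle\cdot,\cdot\rangle$ and norm $\|\cdot\|$. $\Lambda$ is a $P$-dimensional continuous parameter space (manifold) with real coordinates $\lambda=(\lambda^0,\dots,\lambda^{P-1})$. For each $\lambda\in\Lambda$ there is an atom $g_\lambda=U(\lambda)g\in L^2(X)$, where $g\in L^2(X)$, $\|g\|=1$ and $U(\lambda)$ is isometric, so $\|g_\lambda\|=1$. The map $\lambda\mapsto g_\lambda$ is twice differentiable in the components of $\lambda$ (with derivatives in $L^2(X)$), with $\partial_{ij}g_\lambda=\partial_{ji}g_\lambda$, $\partial_i=\partial/\partial\lambda^i$. The dictionary is $\mathcal{D}=\{g_\lambda:\lambda\in\Lambda\}$. It is assumed non-degenerate: $\mathcal{G}_{ij}(\lambda)=\langle\partial_ig_\lambda,\partial_jg_\lambda\rangle$ is positive definite, so $(\Lambda,\mathcal{G}_{ij})$ is a Riemannian manifold. For $\xi\in T_\lambda\Lambda$, $|\xi|^2=\xi^i\xi^j\mathcal{G}_{ij}(\lambda)$ (summation convention). Geodesics. $d_{\mathcal{G}}(\lambda_a,\lambda_b)=\inf_\gamma\int_0^1\|\frac{d}{dt}g_{\gamma(t)}\|\,dt$ over differentiable curves $\gamma:[0,1]\to\Lambda$ from $\lambda_a$ to $\lambda_b$; this is the Riemannian distance of $(\Lambda,\mathcal{G}_{ij})$. It is assumed that a minimizing geodesic exists between any two points of $\Lambda$. Geodesics are parametrized by arc length $s$. Condition number. $\mathcal{K}_\lambda=\sup_{\xi\in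 T_\lambda\Lambda,\,|\xi|=1}\big\|\frac{d^2}{ds^2}g_{\gamma_\xi(s)}|_{s=0}\big\|$, where $\gamma_\xi$ is the unique arc-length geodesic with $\gamma_\xi(0)=\lambda$, $\gamma_\xi'(0)=\xi$. $\mathcal{K}=\sup_{\lambda\in\Lambda}\mathcal{K}_\lambda$. The condition number of $\mathcal{D}$ is $\mathcal{K}^{-1}$ (zero if $\mathcal{K}=\infty$). Matching pursuit. For $\Theta\subseteq\Lambda$ and $\alpha\in(0,1]$, MP$(\Theta,\alpha)$ of $f$ is: $R^0f=f$, and $R^{m+1}f=R^mf-\langle g_{\lambda_{m+1}},R^mf\rangle\,g_{\lambda_{m+1}}$, where $\lambda_{m+1}\in\Theta$ is any parameter with $\langle g_{\lambda_{m+1}},R^mf\rangle^2\ge\alpha^2\sup_{\lambda\in\Theta}\langle g_\lambda,R^mf\rangle^2$. It is assumed that for every $u\in L^2(X)$ a maximizer of $\langle g_\lambda,u\rangle^2$ over $\lambda\in\Theta$ exists. cMP$(\alpha)=$ MP$(\Lambda,\alpha)$ and dMP$(\alpha)=$ MP$(\Lambda_{\rm d},\alpha)$. The exponential convergence rate of cMP$(\alpha')$ on $\mathcal{S}$ is the bound $\|R^mf\|\le(1-\alpha'^2\beta^2)^{m/2}\|f\|$. *)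

theory Defs
  imports "HOL-Analysis.Analysis"
begin

section \<open>The Hilbert space of square-integrable functions\<close>

definition square_integrable :: "'x measure \<Rightarrow> ('x \<Rightarrow> real) \<Rightarrow> bool" where
  "square_integrable M f \<longleftrightarrow> f \<in> borel_measurable M \<and> integrable M (\<lambda>x. (f x)\<^sup>2)"

text \<open>The inner product space \<open>'h\<close> is the space \<open>L\<^sup>2(M)\<close>, and \<open>cls f\<close> is the element given
  by the square-integrable function \<open>f\<close>. The clause on inner products makes \<open>cls\<close> identify exactly
  the functions that agree almost everywhere. This determines \<open>'h\<close> up to isometric isomorphism;
  in particular \<open>'h\<close> is complete.\<close>

definition L2_space :: "'x measure \<Rightarrow> (('x \<Rightarrow> real) \<Rightarrow> 'h::real_inner) \<Rightarrow> bool" where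
  "L2_space M cls \<longleftrightarrow>
     cls ` {f. square_integrable M f} = UNIV \<and>
     (\<forall>f h c. square_integrable M f \<longrightarrow> square_integrable M h \<longrightarrow>
        cls (\<lambda>x. c * f x + h x) = c *\<^sub>R cls f + cls h) \<and>
     (\<forall>f h. square_integrable M f \<longrightarrow> square_integrable M h \<longrightarrow>
        inner (cls f) (cls h) = (LINT x|M. f x * h x))"

section \<open>The parameter manifold\<close>

definition twice_differentiable_on ::
    "('a::real_normed_vector \<Rightarrow> 'b::real_normed_vector) \<Rightarrow> 'a set \<Rightarrow> bool" where
  "twice_differentiable_on f V \<longleftrightarrow>
     (\<exists>D. \<forall>x\<in>V. (f has_derivative blinfun_apply (D x)) (at x) \<and> D differentiable (at x))"

text \<open>A chart \<open>(U, \<phi>)\<close> consists of an open set \<open>U\<close> and a homeomorphism \<open>\<phi>\<close> of \<open>U\<close> onto an open set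
  of coordinates. A dictionary that is only required to be twice differentiable needs no more than
  twice differentiable coordinate changes for everything below to be independent of the
  chart, so smooth manifolds are included. The Hausdorff property and second countability come from
  the type classes of \<open>'l\<close> in the main statement.\<close>

definition manifold_atlas ::
    "'l::topological_space set \<Rightarrow> ('l set \<times> ('l \<Rightarrow> real^'p)) set \<Rightarrow> bool" where
  "manifold_atlas \<Lambda> A \<longleftrightarrow>
     (\<Union>(U, \<phi>)\<in>A. U) = \<Lambda> \<and>
     (\<forall>(U, \<phi>)\<in>A. open U \<and> open (\<phi> ` U) \<and> homeomorphism U (\<phi> ` U) \<phi> (inv_into U \<phi>)) \<and>
     (\<forall>(U, \<phi>)\<in>A. \<forall>(V, \<psi>)\<in>A. twice_differentiable_on (\<psi> \<circ> inv_into U \<phi>) (\<phi> ` (U \<inter> V)))"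

definition differentiable_curve ::
    "'l::topological_space set \<Rightarrow> ('l set \<times> ('l \<Rightarrow> real^'p)) set \<Rightarrow> real set \<Rightarrow> (real \<Rightarrow> 'l) \<Rightarrow> bool"
  where
  "differentiable_curve \<Lambda> A I \<gamma> \<longleftrightarrow>
     continuous_on I \<gamma> \<and> \<gamma> ` I \<subseteq> \<Lambda> \<and>
     (\<forall>(U, \<phi>)\<in>A. \<forall>t \<in> I \<inter> \<gamma> -` U. (\<phi> \<circ> \<gamma>) differentiable (at t within I \<inter> \<gamma> -` U))"

definition partial :: "'p \<Rightarrow> (real^'p \<Rightarrow> 'b::real_normed_vector) \<Rightarrow> real^'p \<Rightarrow> 'b" where
  "partial i f x = vector_derivative (\<lambda>t. f (x + t *\<^sub>R axis i 1)) (at 0)"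

abbreviation in_chart :: "('l \<Rightarrow> 'h) \<Rightarrow> 'l set \<Rightarrow> ('l \<Rightarrow> real^'p) \<Rightarrow> real^'p \<Rightarrow> 'h" where
  "in_chart g U \<phi> \<equiv> g \<circ> inv_into U \<phi>"

definition twice_differentiable_atoms ::
    "('l set \<times> ('l \<Rightarrow> real^'p)) set \<Rightarrow> ('l \<Rightarrow> 'h::real_normed_vector) \<Rightarrow> bool" where
  "twice_differentiable_atoms A g \<longleftrightarrow>
     (\<forall>(U, \<phi>)\<in>A. twice_differentiable_on (in_chart g U \<phi>) (\<phi> ` U) \<and>
        (\<forall>x \<in> \<phi> ` U. \<forall>i j. partial i (partial j (in_chart g U \<phi>)) x
                          = partial j (partial i (in_chart g U \<phi>)) x))"

section \<open>The induced Riemannian metric and its geodesics\<close>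

text \<open>In the following three definitions \<open>G\<close> is the atom map expressed in the coordinates of a
  chart.\<close>

definition metric :: "(real^'p \<Rightarrow> 'h::real_inner) \<Rightarrow> real^'p \<Rightarrow> real^'p^'p" where
  "metric G x = (\<chi> i j. inner (partial i G x) (partial j G x))"

definition metric_norm2 :: "(real^'p \<Rightarrow> 'h::real_inner) \<Rightarrow> real^'p \<Rightarrow> real^'p \<Rightarrow> real" where
  "metric_norm2 G x \<xi> = (\<Sum>i\<in>UNIV. \<Sum>j\<in>UNIV. \<xi> $ i * \<xi> $ j * metric G x $ i $ j)"

definition christoffel ::
    "(real^'p \<Rightarrow> 'h::real_inner) \<Rightarrow> real^'p \<Rightarrow> 'p \<Rightarrow> 'p \<Rightarrow> 'p \<Rightarrow> real" where
  "christoffel G x k i j =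
     (1/2) * (\<Sum>l\<in>UNIV. matrix_inv (metric G x) $ k $ l *
        (partial i (\<lambda>y. metric G y $ l $ j) x + partial j (\<lambda>y. metric G y $ i $ l) x
          - partial l (\<lambda>y. metric G y $ i $ j) x))"

definition nondegenerate ::
    "('l set \<times> ('l \<Rightarrow> real^'p)) set \<Rightarrow> ('l \<Rightarrow> 'h::real_inner) \<Rightarrow> bool" where
  "nondegenerate A g \<longleftrightarrow>
     (\<forall>(U, \<phi>)\<in>A. \<forall>x \<in> \<phi> ` U. \<forall>\<xi>. \<xi> \<noteq> 0 \<longrightarrow> metric_norm2 (in_chart g U \<phi>) x \<xi> > 0)"

text \<open>Geodesics parametrized by arc length on an interval \<open>I\<close>, given by the geodesic equation
  \<open>w\<^sup>k + \<Gamma>\<^sup>k\<^sub>i\<^sub>j v\<^sup>i v\<^sup>j = 0\<close> for the velocity \<open>v\<close> and acceleration \<open>w\<close> in coordinates, together with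
  \<open>|v| = 1\<close>. The witnesses \<open>v\<close> and \<open>w\<close> are used in place of \<open>vector_derivative\<close> so that a constant
  curve on \<open>I = {0}\<close> counts as a geodesic of length zero.\<close>

definition arclength_geodesic ::
    "'l::topological_space set \<Rightarrow> ('l set \<times> ('l \<Rightarrow> real^'p)) set \<Rightarrow> ('l \<Rightarrow> 'h::real_inner)
      \<Rightarrow> real set \<Rightarrow> (real \<Rightarrow> 'l) \<Rightarrow> bool" where
  "arclength_geodesic \<Lambda> A g I \<gamma> \<longleftrightarrow>
     continuous_on I \<gamma> \<and> \<gamma> ` I \<subseteq> \<Lambda> \<and>
     (\<forall>(U, \<phi>)\<in>A. \<exists>v w. \<forall>t \<in> I \<inter> \<gamma> -` U.
        ((\<phi> \<circ> \<gamma>) has_vector_derivative v t) (at t within I \<inter> \<gamma> -` U) \<and>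
        (v has_vector_derivative w t) (at t within I \<inter> \<gamma> -` U) \<and>
        metric_norm2 (in_chart g U \<phi>) (\<phi> (\<gamma> t)) (v t) = 1 \<and>
        (\<forall>k. w t $ k +
           (\<Sum>i\<in>UNIV. \<Sum>j\<in>UNIV. christoffel (in_chart g U \<phi>) (\<phi> (\<gamma> t)) k i j * v t $ i * v t $ j) = 0))"

text \<open>Lengths take values in the extended reals: a differentiable curve whose speed is not
  integrable has length \<open>\<infinity>\<close>, and so has the infimum over an empty set of curves.\<close>

definition curve_length :: "('l \<Rightarrow> 'h::real_normed_vector) \<Rightarrow> (real \<Rightarrow> 'l) \<Rightarrow> ennreal" where
  "curve_length g \<gamma> =
     (\<integral>\<^sup>+t\<in>{0..1}. ennreal (norm (vector_derivative (g \<circ> \<gamma>) (at t within {0..1}))) \<partial>lborel)"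

definition geodesic_dist ::
    "'l::topological_space set \<Rightarrow> ('l set \<times> ('l \<Rightarrow> real^'p)) set \<Rightarrow> ('l \<Rightarrow> 'h::real_normed_vector)
      \<Rightarrow> 'l \<Rightarrow> 'l \<Rightarrow> ennreal" where
  "geodesic_dist \<Lambda> A g a b =
     (INF \<gamma> \<in> {\<gamma>. differentiable_curve \<Lambda> A {0..1} \<gamma> \<and> \<gamma> 0 = a \<and> \<gamma> 1 = b}. curve_length g \<gamma>)"

definition minimizing_geodesics_exist ::
    "'l::topological_space set \<Rightarrow> ('l set \<times> ('l \<Rightarrow> real^'p)) set \<Rightarrow> ('l \<Rightarrow> 'h::real_inner) \<Rightarrow> bool"
  where
  "minimizing_geodesics_exist \<Lambda> A g \<longleftrightarrow>
     (\<forall>a\<in>\<Lambda>. \<forall>b\<in>\<Lambda>. \<exists>L \<gamma>. 0 \<le> L \<and> arclength_geodesic \<Lambda> A g {0..L} \<gamma> \<and>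
        \<gamma> 0 = a \<and> \<gamma> L = b \<and> geodesic_dist \<Lambda> A g a b = ennreal L)"

definition density_radius ::
    "'l::topological_space set \<Rightarrow> ('l set \<times> ('l \<Rightarrow> real^'p)) set \<Rightarrow> ('l \<Rightarrow> 'h::real_normed_vector)
      \<Rightarrow> 'l set \<Rightarrow> ennreal" where
  "density_radius \<Lambda> A g \<Lambda>d = (SUP l\<in>\<Lambda>. INF k\<in>\<Lambda>d. geodesic_dist \<Lambda> A g l k)"

section \<open>The condition number\<close>

text \<open>A unit tangent vector at \<open>l\<close> is given by its components \<open>\<xi>\<close> in some chart around \<open>l\<close>. The
  innermost supremum ranges over the local geodesics \<open>\<gamma>\<^sub>\<xi>\<close> with initial data \<open>(l, \<xi>)\<close>; these agree
  near \<open>0\<close> whenever the geodesic with these data is unique, and then the supremum is the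
  single value at \<open>\<gamma>\<^sub>\<xi>\<close>.\<close>

definition curvature_bound_at ::
    "'l::topological_space set \<Rightarrow> ('l set \<times> ('l \<Rightarrow> real^'p)) set \<Rightarrow> ('l \<Rightarrow> 'h::real_inner)
      \<Rightarrow> 'l \<Rightarrow> ennreal" where
  "curvature_bound_at \<Lambda> A g l =
     (SUP (U, \<phi>) \<in> {(U, \<phi>) \<in> A. l \<in> U}.
      SUP \<xi> \<in> {\<xi>. metric_norm2 (in_chart g U \<phi>) (\<phi> l) \<xi> = 1}.
      SUP \<gamma> \<in> {\<gamma>. (\<exists>e>0. arclength_geodesic \<Lambda> A g {-e<..<e} \<gamma>) \<and> \<gamma> 0 = l \<and>
                  ((\<phi> \<circ> \<gamma>) has_vector_derivative \<xi>) (at 0)}.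
        ennreal (norm (vector_derivative (\<lambda>s. vector_derivative (g \<circ> \<gamma>) (at s)) (at 0))))"

definition curvature_bound ::
    "'l::topological_space set \<Rightarrow> ('l set \<times> ('l \<Rightarrow> real^'p)) set \<Rightarrow> ('l \<Rightarrow> 'h::real_inner) \<Rightarrow> ennreal"
  where
  "curvature_bound \<Lambda> A g = (SUP l\<in>\<Lambda>. curvature_bound_at \<Lambda> A g l)"

definition condition_number ::
    "'l::topological_space set \<Rightarrow> ('l set \<times> ('l \<Rightarrow> real^'p)) set \<Rightarrow> ('l \<Rightarrow> 'h::real_inner) \<Rightarrow> ennreal"
  where
  "condition_number \<Lambda> A g = inverse (curvature_bound \<Lambda> A g)"

section \<open>Matching pursuit\<close>

definition greedy_factor :: "'h::real_inner set \<Rightarrow> 'h set \<Rightarrow> real" where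
  "greedy_factor S D = sqrt (INF u \<in> {u \<in> S. norm u = 1}. SUP a\<in>D. (inner a u)\<^sup>2)"

definition maximizers_exist :: "('l \<Rightarrow> 'h::real_inner) \<Rightarrow> 'l set \<Rightarrow> bool" where
  "maximizers_exist g \<Theta> \<longleftrightarrow> (\<forall>u. \<exists>l\<in>\<Theta>. \<forall>l'\<in>\<Theta>. (inner (g l') u)\<^sup>2 \<le> (inner (g l) u)\<^sup>2)"

text \<open>\<open>R\<close> is a possible sequence of residuals of the weak matching pursuit of \<open>f\<close>.\<close>

definition mp_residuals ::
    "('l \<Rightarrow> 'h::real_inner) \<Rightarrow> 'l set \<Rightarrow> real \<Rightarrow> 'h \<Rightarrow> (nat \<Rightarrow> 'h) \<Rightarrow> bool" where
  "mp_residuals g \<Theta> \<alpha> f R \<longleftrightarrow>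
     R 0 = f \<and>
     (\<forall>m. \<exists>l\<in>\<Theta>. (inner (g l) (R m))\<^sup>2 \<ge> \<alpha>\<^sup>2 * (SUP l'\<in>\<Theta>. (inner (g l') (R m))\<^sup>2) \<and>
        R (Suc m) = R m - inner (g l) (R m) *\<^sub>R g l)"

end

theory Submission
  imports Defs
begin

text \<open>Let \<open>u \<in> S\<close> be a residual and let \<open>l\<close> be a parameter in \<open>\<Lambda>\<close> at which the squared correlation
  \<open>\<langle>g\<^sub>l, u\<rangle>\<^sup>2\<close> is maximal. Join \<open>l\<close> to a nearby parameter \<open>k \<in> \<Lambda>\<^sub>d\<close> by a minimizing geodesic \<open>\<gamma>\<close> of
  length \<open>L\<close> and put \<open>H(s) = \<langle>g\<^sub>\<gamma>\<^sub>(\<^sub>s\<^sub>), u\<rangle>\<^sup>2\<close>. As \<open>l\<close> is a critical point of the squared correlation, \<open>H'(0) = 0\<close>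
  (\<open>squared_correlation_critical\<close>). Moreover
  \<open>H'' = 2\<langle>g', u\<rangle>\<^sup>2 + 2\<langle>g, u\<rangle>\<langle>g'', u\<rangle> \<ge> -2K\<parallel>u\<parallel>\<^sup>2\<close>, because \<open>\<gamma>\<close>, shifted along itself, is one of the
  local geodesics that define \<open>K\<close> (\<open>geodesic_curvature_le\<close>). Taylor's formula yields
  \<open>H(L) \<ge> H(0) - K L\<^sup>2 \<parallel>u\<parallel>\<^sup>2\<close> (\<open>squared_correlation_geodesic_ge\<close>).

  Since \<open>k\<close> can be chosen with \<open>L\<close> arbitrarily close to \<open>\<rho>\<close>, and \<open>\<beta>\<^sup>2\<parallel>u\<parallel>\<^sup>2 \<le> H(0)\<close> by the definition of
  the greedy factor, the best squared correlation over \<open>\<Lambda>\<^sub>d\<close> is at least \<open>1 - \<rho>\<^sup>2(1 + K)/\<beta>\<^sup>2\<close> times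
  the best one over \<open>\<Lambda>\<close>. Hence a selection with weakness \<open>\<alpha>\<close> over \<open>\<Lambda>\<^sub>d\<close> is one with weakness
  \<open>\<alpha>'\<close> over \<open>\<Lambda>\<close>, and each such step removes at least the fraction \<open>\<alpha>'\<^sup>2\<beta>\<^sup>2\<close> of the energy
  \<open>\<parallel>u\<parallel>\<^sup>2\<close>, since the atoms have norm one.\<close>

section \<open>Calculus along curves\<close>

text \<open>Compensating by the extremal parabola makes \<open>H'(t) + 2Ct\<close>, and then \<open>H(t) + Ct\<^sup>2\<close>,
  nondecreasing. The second derivative is bounded on the open interval only, since the curvature
  bound concerns two-sided geodesics and a geodesic segment need not extend beyond its endpoints.\<close>

lemma quadratic_lower_bound:
  fixes H :: "real \<Rightarrow> real"
  assumes "0 \<le> L"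
    and H: "\<And>t. t \<in> {0..L} \<Longrightarrow> (H has_vector_derivative H' t) (at t within {0..L})"
    and H': "\<And>t. t \<in> {0..L} \<Longrightarrow> (H' has_vector_derivative H'' t) (at t within {0..L})"
    and "H' 0 = 0"
    and H'': "\<And>t. 0 < t \<Longrightarrow> t < L \<Longrightarrow> - 2 * C \<le> H'' t"
  shows "H 0 - C * L\<^sup>2 \<le> H L"
proof -
  have cont: "continuous_on {0..L} H" "continuous_on {0..L} H'"
    by (rule continuous_on_vector_derivative, fact H, rule continuous_on_vector_derivative, fact H')
  have dH: "(H has_real_derivative H' t) (at t)" and dH': "(H' has_real_derivative H'' t) (at t)"
    if "0 < t" "t < L" for t
    using H[of t] H'[of t] that
    by (simp_all add: has_real_derivative_iff_has_vector_derivative at_within_Icc_at)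
  have H'_ge: "0 \<le> H' s + 2 * C * s" if "s \<in> {0..L}" for s
  proof -
    have "H' 0 + 2 * C * 0 \<le> H' s + 2 * C * s"
    proof (rule DERIV_nonneg_imp_increasing_open[where f = "\<lambda>t. H' t + 2 * C * t"])
      show "0 \<le> s" using that by simp
      show "\<exists>y. ((\<lambda>t. H' t + 2 * C * t) has_real_derivative y) (at t) \<and> 0 \<le> y"
        if "0 < t" "t < s" for t
        using H''[of t] that \<open>s \<in> {0..L}\<close>
        by (intro exI[of _ "H'' t + 2 * C"]) (auto intro!: derivative_eq_intros dH')
      show "continuous_on {0..s} (\<lambda>t. H' t + 2 * C * t)"
        using that by (intro continuous_intros continuous_on_subset[OF cont(2)]) auto
    qed
    then show ?thesis using \<open>H' 0 = 0\<close> by simp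
  qed
  have "H 0 + C * 0\<^sup>2 \<le> H L + C * L\<^sup>2"
  proof (rule DERIV_nonneg_imp_increasing_open[where f = "\<lambda>t. H t + C * t\<^sup>2"])
    show "0 \<le> L" by fact
    show "\<exists>y. ((\<lambda>t. H t + C * t\<^sup>2) has_real_derivative y) (at t) \<and> 0 \<le> y" if "0 < t" "t < L" for t
      using H'_ge[of t] that
      by (intro exI[of _ "H' t + 2 * C * t"]) (auto intro!: derivative_eq_intros dH)
    show "continuous_on {0..L} (\<lambda>t. H t + C * t\<^sup>2)"
      by (intro continuous_intros cont(1))
  qed
  then show ?thesis by simp
qed

lemma has_vector_derivative_shift_within:
  assumes "(f has_vector_derivative f') (at (t + s) within T)" and "\<And>r. r \<in> J \<Longrightarrow> t + r \<in> T"
  shows "((\<lambda>r. f (t + r)) has_vector_derivative f') (at s within J)"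
proof -
  have "((+) t has_vector_derivative 1) (at s within J)"
    by (auto intro!: derivative_eq_intros)
  moreover have "(f has_vector_derivative f') (at (t + s) within (+) t ` J)"
    using assms by (auto intro: has_vector_derivative_within_subset)
  ultimately show ?thesis
    using vector_diff_chain_within[of "(+) t" 1 s J f f'] by (simp add: o_def)
qed

lemma twice_differentiable_on_along_curve:
  fixes G :: "'a::real_normed_vector \<Rightarrow> 'b::real_normed_vector"
  assumes "twice_differentiable_on G V"
    and "\<forall>t\<in>T. c t \<in> V"
    and "\<forall>t\<in>T. (c has_vector_derivative v t) (at t within T)"
    and "\<forall>t\<in>T. (v has_vector_derivative w t) (at t within T)"
  obtains p q where
    "\<forall>t\<in>T. ((G \<circ> c) has_vector_derivative p t) (at t within T)"
    "\<forall>t\<in>T. (p has_vector_derivative q t) (at t within T)"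
proof -
  note c = assms(2)[rule_format] and c' = assms(3)[rule_format] and c'' = assms(4)[rule_format]
  obtain D where D: "\<And>x. x \<in> V \<Longrightarrow> (G has_derivative blinfun_apply (D x)) (at x)"
    and D': "\<And>x. x \<in> V \<Longrightarrow> D differentiable (at x)"
    using assms(1) unfolding twice_differentiable_on_def by blast
  have first: "((G \<circ> c) has_vector_derivative D (c t) (v t)) (at t within T)" if "t \<in> T" for t
  proof -
    have "((G \<circ> c) has_derivative blinfun_apply (D (c t)) \<circ> (\<lambda>r. r *\<^sub>R v t)) (at t within T)"
      using c'[OF that] D[OF c[OF that]] unfolding has_vector_derivative_def
      by (meson diff_chain_within has_derivative_at_withinI)
    then show ?thesis
      by (simp add: has_vector_derivative_def o_def blinfun.scaleR_right)
  qed
  have second: "\<exists>q. ((\<lambda>t. D (c t) (v t)) has_vector_derivative q) (at t within T)" if "t \<in> T" for t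
  proof -
    obtain E where E: "(D has_derivative E) (at (c t))"
      using D' c \<open>t \<in> T\<close> unfolding differentiable_def by blast
    have "((D \<circ> c) has_derivative E \<circ> (\<lambda>r. r *\<^sub>R v t)) (at t within T)"
      using c'[OF \<open>t \<in> T\<close>] E unfolding has_vector_derivative_def
      by (meson diff_chain_within has_derivative_at_withinI)
    moreover have "E \<circ> (\<lambda>r. r *\<^sub>R v t) = (\<lambda>r. r *\<^sub>R E (v t))"
      using has_derivative_linear[OF E] by (auto simp: linear_cmul)
    ultimately have "((\<lambda>t. D (c t)) has_vector_derivative E (v t)) (at t within T)"
      by (simp add: has_vector_derivative_def o_def)
    from bounded_bilinear.has_vector_derivative[OF bounded_bilinear_blinfun_apply this c''[OF \<open>t \<in> T\<close>]]
    show ?thesis by blast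
  qed
  from second obtain q where
    "\<And>t. t \<in> T \<Longrightarrow> ((\<lambda>t. D (c t) (v t)) has_vector_derivative q t) (at t within T)"
    by metis
  with first show thesis by (intro that ballI)
qed

section \<open>Atoms along geodesics\<close>

lemma manifold_atlasD:
  assumes "manifold_atlas \<Lambda> A"
  shows "l \<in> \<Lambda> \<Longrightarrow> \<exists>V \<phi>. (V, \<phi>) \<in> A \<and> l \<in> V"
    and "(V, \<phi>) \<in> A \<Longrightarrow> V \<subseteq> \<Lambda>"
    and "(V, \<phi>) \<in> A \<Longrightarrow> open V"
    and "(V, \<phi>) \<in> A \<Longrightarrow> open (\<phi> ` V)"
    and "(V, \<phi>) \<in> A \<Longrightarrow> l \<in> V \<Longrightarrow> inv_into V \<phi> (\<phi> l) = l"
proof -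
  note m = assms[unfolded manifold_atlas_def]
  show "\<exists>V \<phi>. (V, \<phi>) \<in> A \<and> l \<in> V" if "l \<in> \<Lambda>" using m that by fastforce
  assume V: "(V, \<phi>) \<in> A"
  show "V \<subseteq> \<Lambda>" using m V by fastforce
  have "open V \<and> open (\<phi> ` V) \<and> homeomorphism V (\<phi> ` V) \<phi> (inv_into V \<phi>)"
    using m V by fast
  then show "open V" "open (\<phi> ` V)" "l \<in> V \<Longrightarrow> inv_into V \<phi> (\<phi> l) = l"
    by (simp_all add: homeomorphism_def)
qed

lemma arclength_geodesic_chart:
  assumes "arclength_geodesic \<Lambda> A g I \<gamma>" "(V, \<phi>) \<in> A"
  obtains v w where
    "\<forall>t \<in> I \<inter> \<gamma> -` V. ((\<phi> \<circ> \<gamma>) has_vector_derivative v t) (at t within I \<inter> \<gamma> -` V)"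
    "\<forall>t \<in> I \<inter> \<gamma> -` V. (v has_vector_derivative w t) (at t within I \<inter> \<gamma> -` V)"
    "\<forall>t \<in> I \<inter> \<gamma> -` V. metric_norm2 (in_chart g V \<phi>) (\<phi> (\<gamma> t)) (v t) = 1"
proof -
  note charts = assms(1)[unfolded arclength_geodesic_def, THEN conjunct2, THEN conjunct2]
  from bspec[OF charts assms(2)] show thesis
    unfolding prod.case by (elim exE) (rule that, auto)
qed

lemma arclength_geodesic_shift:
  assumes \<gamma>: "arclength_geodesic \<Lambda> A g I \<gamma>" and sub: "\<And>s. s \<in> J \<Longrightarrow> t + s \<in> I"
  shows "arclength_geodesic \<Lambda> A g J (\<lambda>s. \<gamma> (t + s))"
  unfolding arclength_geodesic_def
proof (intro conjI ballI)
  have "continuous_on I \<gamma>" "\<gamma> ` I \<subseteq> \<Lambda>"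
    using \<gamma> by (auto simp: arclength_geodesic_def)
  then show "continuous_on J (\<lambda>s. \<gamma> (t + s))" "(\<lambda>s. \<gamma> (t + s)) ` J \<subseteq> \<Lambda>"
    using sub by (auto intro!: continuous_on_compose2[of I \<gamma>] continuous_intros)
  fix V\<phi> assume V: "V\<phi> \<in> A"
  obtain V \<phi> where V\<phi>: "V\<phi> = (V, \<phi>)" by force
  let ?T = "I \<inter> \<gamma> -` V" and ?T' = "J \<inter> (\<lambda>s. \<gamma> (t + s)) -` V"
  obtain v w where vw: "\<And>r. r \<in> ?T \<Longrightarrow>
        ((\<phi> \<circ> \<gamma>) has_vector_derivative v r) (at r within ?T) \<and>
        (v has_vector_derivative w r) (at r within ?T) \<and>
        metric_norm2 (in_chart g V \<phi>) (\<phi> (\<gamma> r)) (v r) = 1 \<and>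
        (\<forall>k. w r $ k + (\<Sum>i\<in>UNIV. \<Sum>j\<in>UNIV.
           christoffel (in_chart g V \<phi>) (\<phi> (\<gamma> r)) k i j * v r $ i * v r $ j) = 0)"
    using \<gamma> V unfolding arclength_geodesic_def V\<phi> by fast
  have T: "t + s \<in> ?T" if "s \<in> ?T'" for s
    using that sub by auto
  show "case V\<phi> of (V, \<phi>) \<Rightarrow> \<exists>v w. \<forall>s\<in>J \<inter> (\<lambda>s. \<gamma> (t + s)) -` V.
        ((\<phi> \<circ> (\<lambda>s. \<gamma> (t + s))) has_vector_derivative v s) (at s within J \<inter> (\<lambda>s. \<gamma> (t + s)) -` V) \<and>
        (v has_vector_derivative w s) (at s within J \<inter> (\<lambda>s. \<gamma> (t + s)) -` V) \<and>
        metric_norm2 (in_chart g V \<phi>) (\<phi> (\<gamma> (t + s))) (v s) = 1 \<and>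
        (\<forall>k. w s $ k + (\<Sum>i\<in>UNIV. \<Sum>j\<in>UNIV.
           christoffel (in_chart g V \<phi>) (\<phi> (\<gamma> (t + s))) k i j * v s $ i * v s $ j) = 0)"
    unfolding V\<phi> prod.case
  proof (rule exI[of _ "\<lambda>s. v (t + s)"], rule exI[of _ "\<lambda>s. w (t + s)"], rule ballI)
    fix s assume s: "s \<in> ?T'"
    have "((\<lambda>s. (\<phi> \<circ> \<gamma>) (t + s)) has_vector_derivative v (t + s)) (at s within ?T')"
      and "((\<lambda>s. v (t + s)) has_vector_derivative w (t + s)) (at s within ?T')"
      using vw[OF T[OF s]] T by (blast intro: has_vector_derivative_shift_within)+
    with vw[OF T[OF s]]
    show "((\<phi> \<circ> (\<lambda>s. \<gamma> (t + s))) has_vector_derivative v (t + s)) (at s within ?T') \<and>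
        ((\<lambda>s. v (t + s)) has_vector_derivative w (t + s)) (at s within ?T') \<and>
        metric_norm2 (in_chart g V \<phi>) (\<phi> (\<gamma> (t + s))) (v (t + s)) = 1 \<and>
        (\<forall>k. w (t + s) $ k + (\<Sum>i\<in>UNIV. \<Sum>j\<in>UNIV.
           christoffel (in_chart g V \<phi>) (\<phi> (\<gamma> (t + s))) k i j * v (t + s) $ i * v (t + s) $ j) = 0)"
      by (simp add: o_def)
  qed
qed

lemma at_within_preimage_open:
  assumes "continuous_on I \<gamma>" "open V" "t \<in> I" "\<gamma> t \<in> V"
  shows "at t within I \<inter> \<gamma> -` V = at t within I"
proof -
  obtain W where W: "open W" "W \<inter> I = \<gamma> -` V \<inter> I"
    using assms(1,2) by (meson continuous_on_open_invariant)
  then have "t \<in> W" using assms(3,4) by blast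
  with W show ?thesis by (intro at_within_nhd[of t W]) auto
qed

text \<open>The first derivative \<open>p\<close> does not depend on the chart in which it is computed. This is what
  lets the second derivatives found in the various charts fit together to a derivative of one
  function \<open>p\<close> on the whole interval.\<close>

lemma geodesic_atom_twice_differentiable:
  assumes M: "manifold_atlas \<Lambda> A" and g: "twice_differentiable_atoms A g"
    and \<gamma>: "arclength_geodesic \<Lambda> A g {0..L} \<gamma>" and "0 < L"
  obtains p q where
    "\<And>t. t \<in> {0..L} \<Longrightarrow> ((g \<circ> \<gamma>) has_vector_derivative p t) (at t within {0..L})"
    "\<And>t. t \<in> {0..L} \<Longrightarrow> (p has_vector_derivative q t) (at t within {0..L})"
proof -
  let ?I = "{0..L}"
  let ?p = "\<lambda>t. vector_derivative (g \<circ> \<gamma>) (at t within ?I)"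
  have cont: "continuous_on ?I \<gamma>" and range: "\<gamma> ` ?I \<subseteq> \<Lambda>"
    using \<gamma> by (auto simp: arclength_geodesic_def)
  have "\<exists>q. ((g \<circ> \<gamma>) has_vector_derivative ?p t) (at t within ?I) \<and>
      (?p has_vector_derivative q) (at t within ?I)" if t: "t \<in> ?I" for t
  proof -
    have "\<gamma> t \<in> \<Lambda>" using range t by (rule subsetD[OF _ imageI])
    then obtain V \<phi> where V: "(V, \<phi>) \<in> A" "\<gamma> t \<in> V"
      using manifold_atlasD(1)[OF M] by blast
    let ?T = "?I \<inter> \<gamma> -` V"
    have within: "at s within ?T = at s within ?I" if "s \<in> ?T" for s
      using at_within_preimage_open[OF cont manifold_atlasD(3)[OF M V(1)]] that by blast
    obtain v w where
      vw: "\<forall>s\<in>?T. ((\<phi> \<circ> \<gamma>) has_vector_derivative v s) (at s within ?T)"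
        "\<forall>s\<in>?T. (v has_vector_derivative w s) (at s within ?T)"
        "\<forall>s\<in>?T. metric_norm2 (in_chart g V \<phi>) (\<phi> (\<gamma> s)) (v s) = 1"
      by (rule arclength_geodesic_chart[OF \<gamma> V(1)])
    have "twice_differentiable_on (in_chart g V \<phi>) (\<phi> ` V)"
      using g V(1) unfolding twice_differentiable_atoms_def by blast
    moreover have "\<forall>s\<in>?T. (\<phi> \<circ> \<gamma>) s \<in> \<phi> ` V" by simp
    ultimately obtain p q where
      pq: "\<forall>s\<in>?T. ((in_chart g V \<phi> \<circ> (\<phi> \<circ> \<gamma>)) has_vector_derivative p s) (at s within ?T)"
        "\<forall>s\<in>?T. (p has_vector_derivative q s) (at s within ?T)"
      using vw(1,2) by (rule twice_differentiable_on_along_curve)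
    have p: "((g \<circ> \<gamma>) has_vector_derivative p s) (at s within ?I)" if s: "s \<in> ?T" for s
    proof -
      have "((g \<circ> \<gamma>) has_vector_derivative p s) (at s within ?T)"
        by (rule has_vector_derivative_transform[OF s _ bspec[OF pq(1) s]])
          (use manifold_atlasD(5)[OF M V(1)] in auto)
      then show ?thesis unfolding within[OF s] .
    qed
    have p_eq: "?p s = p s" if "s \<in> ?T" for s
      by (rule vector_derivative_within[OF _ p[OF that]])
        (use that \<open>0 < L\<close> in \<open>simp add: trivial_limit_within islimpt_Icc\<close>)
    have tT: "t \<in> ?T" using t V(2) by simp
    have "(?p has_vector_derivative q t) (at t within ?T)"
      by (rule has_vector_derivative_transform[OF tT _ bspec[OF pq(2) tT]]) (rule p_eq)
    then have "(?p has_vector_derivative q t) (at t within ?I)"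
      unfolding within[OF tT] .
    with p[OF tT] p_eq[OF tT] show ?thesis by auto
  qed
  then obtain q where "\<And>t. t \<in> ?I \<Longrightarrow> ((g \<circ> \<gamma>) has_vector_derivative ?p t) (at t within ?I) \<and>
      (?p has_vector_derivative q t) (at t within ?I)" by metis
  then show thesis by (intro that[of ?p q]) auto
qed

text \<open>At an interior time \<open>t\<close> the shifted curve \<open>s \<mapsto> \<gamma>(t + s)\<close> is a local geodesic through
  \<open>\<gamma>(t)\<close> on an open interval around \<open>0\<close>, so it competes in the supremum that defines the curvature
  bound at \<open>\<gamma>(t)\<close>.\<close>

lemma geodesic_curvature_le:
  assumes M: "manifold_atlas \<Lambda> A"
    and \<gamma>: "arclength_geodesic \<Lambda> A g {0..L} \<gamma>" and t: "0 < t" "t < L"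
    and p: "\<And>s. s \<in> {0..L} \<Longrightarrow> ((g \<circ> \<gamma>) has_vector_derivative p s) (at s within {0..L})"
    and q: "(p has_vector_derivative q) (at t within {0..L})"
  shows "ennreal (norm q) \<le> curvature_bound \<Lambda> A g"
proof -
  let ?\<delta> = "\<lambda>s. \<gamma> (t + s)"
  define e where "e = min t (L - t)"
  have e: "0 < e" using t by (simp add: e_def)
  have I: "0 < t + s \<and> t + s < L" if "s \<in> {-e<..<e}" for s
    using that by (auto simp: e_def)
  have \<delta>: "arclength_geodesic \<Lambda> A g {-e<..<e} ?\<delta>"
    by (rule arclength_geodesic_shift[OF \<gamma>]) (use I in fastforce)
  have "\<gamma> t \<in> \<Lambda>" using \<gamma> t by (auto simp: arclength_geodesic_def)
  then obtain V \<phi> where V: "(V, \<phi>) \<in> A" "\<gamma> t \<in> V"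
    using manifold_atlasD(1)[OF M] by blast
  let ?T = "{-e<..<e} \<inter> ?\<delta> -` V"
  have 0: "0 \<in> ?T" using e V(2) by simp
  have "at 0 within ?T = at 0 within {-e<..<e}"
    by (rule at_within_preimage_open)
      (use \<delta> e V(2) manifold_atlasD(3)[OF M V(1)] in \<open>auto simp: arclength_geodesic_def\<close>)
  also have "\<dots> = at 0" using e by (intro at_within_open) auto
  finally have at0: "at 0 within ?T = at 0" .
  obtain \<xi> where \<xi>: "((\<phi> \<circ> ?\<delta>) has_vector_derivative \<xi>) (at 0)"
    "metric_norm2 (in_chart g V \<phi>) (\<phi> (\<gamma> t)) \<xi> = 1"
  proof -
    obtain v w where v: "\<forall>s\<in>?T. ((\<phi> \<circ> ?\<delta>) has_vector_derivative v s) (at s within ?T)"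
      "\<forall>s\<in>?T. (v has_vector_derivative w s) (at s within ?T)"
      "\<forall>s\<in>?T. metric_norm2 (in_chart g V \<phi>) (\<phi> (\<gamma> (t + s))) (v s) = 1"
      by (rule arclength_geodesic_chart[OF \<delta> V(1)])
    from v(1,3)[THEN bspec, OF 0] show thesis
      unfolding at0 by (intro that[of "v 0"]) auto
  qed
  have at_open: "at s within {-e<..<e} = at s" if "s \<in> {-e<..<e}" for s
    using that by (intro at_within_open) auto
  have first: "vector_derivative (g \<circ> ?\<delta>) (at s) = p (t + s)" if s: "s \<in> {-e<..<e}" for s
  proof -
    have "((\<lambda>r. (g \<circ> \<gamma>) (t + r)) has_vector_derivative p (t + s)) (at s within {-e<..<e})"
      by (rule has_vector_derivative_shift_within[OF p]) (use I s in fastforce)+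
    then show ?thesis
      unfolding at_open[OF s] by (intro vector_derivative_at) (simp add: o_def)
  qed
  have "((\<lambda>s. p (t + s)) has_vector_derivative q) (at 0 within {-e<..<e})"
    by (rule has_vector_derivative_shift_within[where T = "{0..L}"]) (use q I in fastforce)+
  then have "((\<lambda>s. vector_derivative (g \<circ> ?\<delta>) (at s)) has_vector_derivative q) (at 0 within {-e<..<e})"
    by (rule has_vector_derivative_transform[rotated 2]) (use e first in auto)
  then have "vector_derivative (\<lambda>s. vector_derivative (g \<circ> ?\<delta>) (at s)) (at 0) = q"
    using e by (intro vector_derivative_at) (simp add: at_open)
  moreover have "ennreal (norm (vector_derivative (\<lambda>s. vector_derivative (g \<circ> ?\<delta>) (at s)) (at 0)))
      \<le> curvature_bound_at \<Lambda> A g (\<gamma> t)"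
    unfolding curvature_bound_at_def
    by (rule SUP_upper2[of "(V, \<phi>)"], use V in simp, unfold prod.case,
        rule SUP_upper2[of \<xi>], use \<xi>(2) in simp,
        rule SUP_upper2[of ?\<delta>], use \<delta> e \<xi>(1) in auto)
  moreover have "curvature_bound_at \<Lambda> A g (\<gamma> t) \<le> curvature_bound \<Lambda> A g"
    unfolding curvature_bound_def by (rule SUP_upper) fact
  ultimately show ?thesis by simp
qed

section \<open>Correlations near a maximizer\<close>

text \<open>The curve starts at the maximizer, so its one-sided derivative there need not vanish for
  reasons of one variable. It vanishes because the maximizer is interior to a chart, in which the
  full derivative of the squared correlation is zero.\<close>

lemma squared_correlation_critical:
  assumes M: "manifold_atlas \<Lambda> A" and g: "twice_differentiable_atoms A g"
    and \<gamma>: "arclength_geodesic \<Lambda> A g {0..L} \<gamma>" and "0 < L"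
    and max: "\<And>l. l \<in> \<Lambda> \<Longrightarrow> (inner (g l) u)\<^sup>2 \<le> (inner (g (\<gamma> 0)) u)\<^sup>2"
    and p: "((g \<circ> \<gamma>) has_vector_derivative p) (at 0 within {0..L})"
  shows "inner (g (\<gamma> 0)) u * inner p u = 0"
proof -
  have cont: "continuous_on {0..L} \<gamma>" and "\<gamma> 0 \<in> \<Lambda>"
    using \<gamma> \<open>0 < L\<close> by (auto simp: arclength_geodesic_def)
  then obtain V \<phi> where V: "(V, \<phi>) \<in> A" "\<gamma> 0 \<in> V"
    using manifold_atlasD(1)[OF M] by blast
  let ?G = "in_chart g V \<phi>" and ?T = "{0..L} \<inter> \<gamma> -` V"
  have 0: "0 \<in> ?T" using \<open>0 < L\<close> V(2) by simp
  have within: "at 0 within ?T = at 0 within {0..L}"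
    using at_within_preimage_open[OF cont manifold_atlasD(3)[OF M V(1)]] 0 by blast
  have inv: "inv_into V \<phi> (\<phi> l) = l" if "l \<in> V" for l
    using manifold_atlasD(5)[OF M V(1) that] .
  have "twice_differentiable_on ?G (\<phi> ` V)"
    using g V(1) unfolding twice_differentiable_atoms_def by blast
  then obtain D where D: "(?G has_derivative D) (at (\<phi> (\<gamma> 0)))"
    using V(2) unfolding twice_differentiable_on_def by blast
  define h where "h x = (inner (?G x) u)\<^sup>2" for x
  have h: "(h has_derivative (\<lambda>y. 2 * (inner (g (\<gamma> 0)) u * inner (D y) u))) (at (\<phi> (\<gamma> 0)))"
    unfolding h_def by (auto intro!: derivative_eq_intros D[unfolded o_def] simp: inv[OF V(2)])
  have "(\<lambda>y. 2 * (inner (g (\<gamma> 0)) u * inner (D y) u)) = (\<lambda>y. 0)"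
  proof (rule differential_zero_maxmin[OF _ _ h])
    show "\<phi> (\<gamma> 0) \<in> \<phi> ` V" using V(2) by blast
    show "open (\<phi> ` V)" using manifold_atlasD(4)[OF M V(1)] .
    show "(\<forall>y\<in>\<phi> ` V. h y \<le> h (\<phi> (\<gamma> 0))) \<or> (\<forall>y\<in>\<phi> ` V. h (\<phi> (\<gamma> 0)) \<le> h y)"
      using max manifold_atlasD(2)[OF M V(1)] V(2) by (auto simp: h_def inv)
  qed
  then have zero: "inner (g (\<gamma> 0)) u * inner (D y) u = 0" for y
    by (metis mult_eq_0_iff zero_neq_numeral)
  obtain v where v: "((\<phi> \<circ> \<gamma>) has_vector_derivative v) (at 0 within ?T)"
    by (rule arclength_geodesic_chart[OF \<gamma> V(1)]) (use 0 that in blast)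
  have "((?G \<circ> (\<phi> \<circ> \<gamma>)) has_derivative D \<circ> (\<lambda>r. r *\<^sub>R v)) (at 0 within ?T)"
    using v D unfolding has_vector_derivative_def
    by (metis comp_apply diff_chain_within has_derivative_at_withinI)
  moreover have "D \<circ> (\<lambda>r. r *\<^sub>R v) = (\<lambda>r. r *\<^sub>R D v)"
    using has_derivative_linear[OF D] by (auto simp: linear_cmul)
  ultimately have "((?G \<circ> (\<phi> \<circ> \<gamma>)) has_vector_derivative D v) (at 0 within ?T)"
    by (simp add: has_vector_derivative_def)
  then have "((g \<circ> \<gamma>) has_vector_derivative D v) (at 0 within ?T)"
    by (rule has_vector_derivative_transform[OF 0, rotated]) (auto simp: inv)
  then have "((g \<circ> \<gamma>) has_vector_derivative D v) (at 0 within {0..L})"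
    unfolding within .
  from vector_derivative_unique_within[OF _ this p] \<open>0 < L\<close> have "p = D v"
    by (simp add: trivial_limit_within islimpt_Icc)
  then show ?thesis using zero by simp
qed

lemma squared_correlation_geodesic_ge:
  assumes M: "manifold_atlas \<Lambda> A" and g: "twice_differentiable_atoms A g"
    and \<gamma>: "arclength_geodesic \<Lambda> A g {0..L} \<gamma>" and "0 \<le> L"
    and unit: "\<And>l. l \<in> \<Lambda> \<Longrightarrow> norm (g l) = 1"
    and max: "\<And>l. l \<in> \<Lambda> \<Longrightarrow> (inner (g l) u)\<^sup>2 \<le> (inner (g (\<gamma> 0)) u)\<^sup>2"
    and K: "curvature_bound \<Lambda> A g \<le> ennreal K" "0 \<le> K"
  shows "(inner (g (\<gamma> 0)) u)\<^sup>2 - K * (norm u)\<^sup>2 * L\<^sup>2 \<le> (inner (g (\<gamma> L)) u)\<^sup>2"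
proof (cases "L = 0")
  case True
  then show ?thesis by simp
next
  case False
  with \<open>0 \<le> L\<close> have "0 < L" by simp
  obtain p q where p: "\<And>t. t \<in> {0..L} \<Longrightarrow> ((g \<circ> \<gamma>) has_vector_derivative p t) (at t within {0..L})"
    and q: "\<And>t. t \<in> {0..L} \<Longrightarrow> (p has_vector_derivative q t) (at t within {0..L})"
    using geodesic_atom_twice_differentiable[OF M g \<gamma> \<open>0 < L\<close>] by blast
  let ?F = "\<lambda>t. inner (g (\<gamma> t)) u" and ?F' = "\<lambda>t. inner (p t) u" and ?F'' = "\<lambda>t. inner (q t) u"
  have F: "(?F has_real_derivative ?F' t) (at t within {0..L})"
    and F': "(?F' has_real_derivative ?F'' t) (at t within {0..L})" if "t \<in> {0..L}" for t
    using bounded_linear.has_vector_derivative[OF bounded_linear_inner_left[of u] p[OF that]]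
      bounded_linear.has_vector_derivative[OF bounded_linear_inner_left[of u] q[OF that]]
    by (simp_all add: has_real_derivative_iff_has_vector_derivative)
  show ?thesis
  proof (rule quadratic_lower_bound)
    show "0 \<le> L" by fact
    show "((\<lambda>t. (?F t)\<^sup>2) has_vector_derivative 2 * (?F t * ?F' t)) (at t within {0..L})"
      if "t \<in> {0..L}" for t
      unfolding has_real_derivative_iff_has_vector_derivative[symmetric]
      by (auto intro!: derivative_eq_intros F that)
    show "((\<lambda>t. 2 * (?F t * ?F' t)) has_vector_derivative 2 * (?F t * ?F'' t + (?F' t)\<^sup>2))
        (at t within {0..L})" if "t \<in> {0..L}" for t
      unfolding has_real_derivative_iff_has_vector_derivative[symmetric]
      by (auto intro!: derivative_eq_intros F F' that simp: power2_eq_square)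
    show "2 * (?F 0 * ?F' 0) = 0"
      using squared_correlation_critical[OF M g \<gamma> \<open>0 < L\<close> max p] \<open>0 < L\<close> by simp
    show "- 2 * (K * (norm u)\<^sup>2) \<le> 2 * (?F t * ?F'' t + (?F' t)\<^sup>2)" if t: "0 < t" "t < L" for t
    proof -
      have "ennreal (norm (q t)) \<le> ennreal K"
        using geodesic_curvature_le[OF M \<gamma> t p q] t K(1) by (meson atLeastAtMost_iff less_imp_le order_trans)
      then have "norm (q t) \<le> K" using K(2) by simp
      then have "\<bar>?F'' t\<bar> \<le> K * norm u"
        using Cauchy_Schwarz_ineq2[of "q t" u] by (meson mult_right_mono norm_ge_zero order_trans)
      moreover have "\<gamma> t \<in> \<Lambda>" using \<gamma> t by (auto simp: arclength_geodesic_def)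
      then have "\<bar>?F t\<bar> \<le> norm u"
        using Cauchy_Schwarz_ineq2[of "g (\<gamma> t)" u] unit by simp
      ultimately have "\<bar>?F t * ?F'' t\<bar> \<le> norm u * (K * norm u)"
        unfolding abs_mult by (intro mult_mono) auto
      then have "- (K * (norm u)\<^sup>2) \<le> ?F t * ?F'' t"
        by (simp add: power2_eq_square algebra_simps)
      then show ?thesis
        by (smt (verit) zero_le_power2)
    qed
  qed
qed

text \<open>The infimum defining the distance from \<open>l\<close> to \<open>\<Lambda>\<^sub>d\<close> need not be attained. The bound is
  therefore obtained for every radius \<open>r > \<rho>\<close>, and \<open>r\<close> then tends to \<open>\<rho>\<close>, the maximizer \<open>k\<close> over
  \<open>\<Lambda>\<^sub>d\<close> being independent of \<open>r\<close>.\<close>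

lemma discrete_correlation_ge:
  assumes M: "manifold_atlas \<Lambda> A" and g: "twice_differentiable_atoms A g"
    and geod: "minimizing_geodesics_exist \<Lambda> A g"
    and unit: "\<And>l. l \<in> \<Lambda> \<Longrightarrow> norm (g l) = 1"
    and l: "l \<in> \<Lambda>" "\<And>l'. l' \<in> \<Lambda> \<Longrightarrow> (inner (g l') u)\<^sup>2 \<le> (inner (g l) u)\<^sup>2"
    and k: "\<And>k'. k' \<in> \<Lambda>d \<Longrightarrow> (inner (g k') u)\<^sup>2 \<le> (inner (g k) u)\<^sup>2"
    and sub: "\<Lambda>d \<subseteq> \<Lambda>"
    and K: "curvature_bound \<Lambda> A g \<le> ennreal K" "0 \<le> K"
    and \<rho>: "density_radius \<Lambda> A g \<Lambda>d \<le> ennreal \<rho>" "0 \<le> \<rho>"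
  shows "(inner (g l) u)\<^sup>2 - K * (norm u)\<^sup>2 * \<rho>\<^sup>2 \<le> (inner (g k) u)\<^sup>2"
proof -
  have bound: "(inner (g l) u)\<^sup>2 - K * (norm u)\<^sup>2 * r\<^sup>2 \<le> (inner (g k) u)\<^sup>2" if r: "\<rho> < r" for r
  proof -
    have "(INF k\<in>\<Lambda>d. geodesic_dist \<Lambda> A g l k) \<le> density_radius \<Lambda> A g \<Lambda>d"
      unfolding density_radius_def using l(1) by (rule SUP_upper)
    also have "\<dots> < ennreal r"
      using \<rho> r by (metis ennreal_less_iff le_less_trans)
    finally obtain k' where k': "k' \<in> \<Lambda>d" "geodesic_dist \<Lambda> A g l k' < ennreal r"
      by (auto simp: INF_less_iff)
    obtain L \<gamma> where L: "0 \<le> L" "arclength_geodesic \<Lambda> A g {0..L} \<gamma>" "\<gamma> 0 = l" "\<gamma> L = k'"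
      and "geodesic_dist \<Lambda> A g l k' = ennreal L"
      using geod l(1) k'(1) sub unfolding minimizing_geodesics_exist_def by blast
    with k'(2) have "L < r" by (simp add: ennreal_less_iff)
    with L(1) have "K * (norm u)\<^sup>2 * L\<^sup>2 \<le> K * (norm u)\<^sup>2 * r\<^sup>2"
      using K(2) by (intro mult_left_mono power_mono) auto
    then show ?thesis
      using squared_correlation_geodesic_ge[OF M g L(2,1) unit _ K, of u] l(2) k[OF k'(1)] L(3,4)
      by fastforce
  qed
  show ?thesis
  proof (rule tendsto_upperbound)
    show "((\<lambda>r. (inner (g l) u)\<^sup>2 - K * (norm u)\<^sup>2 * r\<^sup>2) \<longlongrightarrow>
        (inner (g l) u)\<^sup>2 - K * (norm u)\<^sup>2 * \<rho>\<^sup>2) (at_right \<rho>)"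
      by (intro tendsto_intros)
    show "\<forall>\<^sub>F r in at_right \<rho>. (inner (g l) u)\<^sup>2 - K * (norm u)\<^sup>2 * r\<^sup>2 \<le> (inner (g k) u)\<^sup>2"
      using bound by (auto simp: eventually_at_filter)
  qed simp
qed

section \<open>Matching pursuit\<close>

lemma greedy_factor_le:
  assumes "subspace S" "u \<in> S"
    and a: "a \<in> D" "\<And>b. b \<in> D \<Longrightarrow> (inner b u)\<^sup>2 \<le> (inner a u)\<^sup>2"
    and unit: "\<And>b. b \<in> D \<Longrightarrow> norm b = 1"
    and pos: "0 < greedy_factor S D"
  shows "(greedy_factor S D)\<^sup>2 * (norm u)\<^sup>2 \<le> (inner a u)\<^sup>2"
proof (cases "u = 0")
  case False
  let ?c = "\<lambda>u. SUP b\<in>D. (inner b u)\<^sup>2"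
  let ?n = "u /\<^sub>R norm u"
  have n: "?n \<in> {u \<in> S. norm u = 1}"
    using assms(1,2) False by (simp add: subspace_scale)
  have nonneg: "0 \<le> ?c v" for v
  proof (rule cSUP_upper2[OF _ a(1)])
    have "(inner b v)\<^sup>2 \<le> (norm v)\<^sup>2" if "b \<in> D" for b
      using Cauchy_Schwarz_ineq2[of b v] unit[OF that] by (intro power2_le_iff_abs_le[THEN iffD2]) auto
    then show "bdd_above ((\<lambda>b. (inner b v)\<^sup>2) ` D)"
      by (intro bdd_aboveI2)
  qed simp
  \<comment> \<open>A positive square root has a positive radicand, so squaring undoes it.\<close>
  have "(greedy_factor S D)\<^sup>2 = (INF u \<in> {u \<in> S. norm u = 1}. ?c u)"
    using pos unfolding greedy_factor_def by simp
  also have "\<dots> \<le> ?c ?n"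
    by (rule cINF_lower[OF _ n]) (rule bdd_belowI2[OF nonneg])
  also have "\<dots> \<le> (inner a u)\<^sup>2 / (norm u)\<^sup>2"
  proof (rule cSUP_least)
    show "D \<noteq> {}" using a(1) by blast
    show "(inner b ?n)\<^sup>2 \<le> (inner a u)\<^sup>2 / (norm u)\<^sup>2" if "b \<in> D" for b
      using a(2)[OF that] by (simp add: power_mult_distrib field_simps divide_right_mono power_divide)
  qed
  finally show ?thesis
    using False by (simp add: field_simps)
qed simp

lemma norm_diff_projection:
  assumes "norm a = 1"
  shows "(norm (u - inner a u *\<^sub>R a))\<^sup>2 = (norm u)\<^sup>2 - (inner a u)\<^sup>2"
proof -
  have "inner a a = 1" using assms by (simp add: norm_eq_1)
  then have "inner (u - inner a u *\<^sub>R a) (u - inner a u *\<^sub>R a) = inner u u - (inner a u)\<^sup>2"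
    by (simp add: inner_diff_left inner_diff_right inner_commute power2_eq_square)
  then show ?thesis by (simp add: power2_norm_eq_inner)
qed

theorem theorem1:
  fixes M :: "'x measure"
    and cls :: "('x \<Rightarrow> real) \<Rightarrow> 'h::real_inner"
    and \<Lambda> :: "'l::{t2_space, second_countable_topology} set"
    and A :: "('l set \<times> ('l \<Rightarrow> real^'p)) set"
    and U :: "'l \<Rightarrow> 'h \<Rightarrow> 'h"
    and g\<^sub>0 :: 'h
    and g :: "'l \<Rightarrow> 'h"
    and S :: "'h set"
    and \<Lambda>d :: "'l set"
    and \<alpha> \<alpha>' \<beta> K \<rho> :: real
  assumes "L2_space M cls"
    and "manifold_atlas \<Lambda> A"
    and "norm g\<^sub>0 = 1"
    and "\<And>l h. l \<in> \<Lambda> \<Longrightarrow> norm (U l h) = norm h"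
    and "\<And>l. l \<in> \<Lambda> \<Longrightarrow> g l = U l g\<^sub>0"
    and "twice_differentiable_atoms A g"
    and "nondegenerate A g"
    and "minimizing_geodesics_exist \<Lambda> A g"
    and "maximizers_exist g \<Lambda>"
    and "maximizers_exist g \<Lambda>d"
    and "subspace S" and "complete S" and "g ` \<Lambda> \<subseteq> S"
    and "\<beta> = greedy_factor S (g ` \<Lambda>)" and "\<beta> > 0"
    and "condition_number \<Lambda> A g \<noteq> 0"
    and "K = enn2real (curvature_bound \<Lambda> A g)"
    and "\<Lambda>d \<subseteq> \<Lambda>" and "countable \<Lambda>d"
    and "density_radius \<Lambda> A g \<Lambda>d < ennreal (\<beta> / sqrt (1 + K))"
    and "\<rho> = enn2real (density_radius \<Lambda> A g \<Lambda>d)"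
    and "0 < \<alpha>" and "\<alpha> \<le> 1"
    and "\<alpha>' = \<alpha> * sqrt (1 - \<rho>\<^sup>2 * (1 + K) / \<beta>\<^sup>2)"
  shows "\<alpha>' \<le> \<alpha> \<and>
    (\<forall>f\<in>S. \<forall>R. mp_residuals g \<Lambda>d \<alpha> f R \<longrightarrow>
       (\<forall>m. norm (R m) \<le> sqrt (1 - \<alpha>'\<^sup>2 * \<beta>\<^sup>2) ^ m * norm f))"
proof -
  have unit: "norm (g l) = 1" if "l \<in> \<Lambda>" for l
    using assms(3,4,5) that by simp
  have "curvature_bound \<Lambda> A g \<noteq> top"
    using assms(16) unfolding condition_number_def by auto
  then have K: "curvature_bound \<Lambda> A g \<le> ennreal K" "0 \<le> K"
    using assms(17) by (simp_all add: less_top)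
  have "density_radius \<Lambda> A g \<Lambda>d < top"
    using assms(20) by (meson ennreal_less_top less_trans)
  then have dens: "density_radius \<Lambda> A g \<Lambda>d = ennreal \<rho>" and \<rho>: "0 \<le> \<rho>"
    using assms(21) by simp_all
  define \<kappa> where "\<kappa> = \<rho>\<^sup>2 * (1 + K) / \<beta>\<^sup>2"
  have "\<rho> < \<beta> / sqrt (1 + K)"
    using assms(20) \<rho> unfolding dens by (simp add: ennreal_less_iff)
  then have "\<rho> * sqrt (1 + K) < \<beta>"
    using K(2) by (simp add: field_simps)
  then have "(\<rho> * sqrt (1 + K))\<^sup>2 < \<beta>\<^sup>2"
    using K(2) \<rho> by (intro power_strict_mono) auto
  then have \<kappa>: "0 \<le> \<kappa>" "\<kappa> < 1"
    using K(2) \<open>\<beta> > 0\<close> by (simp_all add: \<kappa>_def power_mult_distrib)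
  have \<alpha>': "\<alpha>' = \<alpha> * sqrt (1 - \<kappa>)"
    using assms(24) unfolding \<kappa>_def .
  \<comment> \<open>\<open>l\<close> and \<open>k\<close> are the best parameters in \<open>\<Lambda>\<close> and \<open>\<Lambda>d\<close>; \<open>j\<close> is the one that the pursuit selects.\<close>
  have step: "norm (R (Suc m)) \<le> sqrt (1 - \<alpha>'\<^sup>2 * \<beta>\<^sup>2) * norm (R m)"
    if R: "mp_residuals g \<Lambda>d \<alpha> f R" and "R m \<in> S" for f R m
  proof -
    let ?u = "R m"
    obtain l where l: "l \<in> \<Lambda>" "\<And>l'. l' \<in> \<Lambda> \<Longrightarrow> (inner (g l') ?u)\<^sup>2 \<le> (inner (g l) ?u)\<^sup>2"
      using assms(9) unfolding maximizers_exist_def by blast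
    obtain k where k: "k \<in> \<Lambda>d" "\<And>k'. k' \<in> \<Lambda>d \<Longrightarrow> (inner (g k') ?u)\<^sup>2 \<le> (inner (g k) ?u)\<^sup>2"
      using assms(10) unfolding maximizers_exist_def by blast
    obtain j where j: "j \<in> \<Lambda>d" "\<alpha>\<^sup>2 * (SUP k'\<in>\<Lambda>d. (inner (g k') ?u)\<^sup>2) \<le> (inner (g j) ?u)\<^sup>2"
      and Suc: "R (Suc m) = ?u - inner (g j) ?u *\<^sub>R g j"
      using R unfolding mp_residuals_def by blast
    have \<beta>: "\<beta>\<^sup>2 * (norm ?u)\<^sup>2 \<le> (inner (g l) ?u)\<^sup>2"
      unfolding assms(14)
      by (rule greedy_factor_le[OF assms(11) \<open>R m \<in> S\<close>]) (use l unit assms(14,15) in auto)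
    have "K * (norm ?u)\<^sup>2 * \<rho>\<^sup>2 \<le> (1 + K) * (norm ?u)\<^sup>2 * \<rho>\<^sup>2"
      by (intro mult_right_mono) auto
    also have "\<dots> = \<kappa> * (\<beta>\<^sup>2 * (norm ?u)\<^sup>2)"
      using \<open>\<beta> > 0\<close> by (simp add: \<kappa>_def)
    also have "\<dots> \<le> \<kappa> * (inner (g l) ?u)\<^sup>2"
      using \<beta> \<kappa>(1) by (rule mult_left_mono)
    finally have "(1 - \<kappa>) * (inner (g l) ?u)\<^sup>2 \<le> (inner (g k) ?u)\<^sup>2"
      using discrete_correlation_ge[OF assms(2,6,8) unit l k(2) assms(18) K eq_refl[OF dens] \<rho>]
      by (simp add: algebra_simps)
    moreover have "(inner (g k) ?u)\<^sup>2 \<le> (SUP k'\<in>\<Lambda>d. (inner (g k') ?u)\<^sup>2)"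
      using k by (intro cSUP_upper bdd_aboveI2) auto
    moreover have "(1 - \<kappa>) * (\<beta>\<^sup>2 * (norm ?u)\<^sup>2) \<le> (1 - \<kappa>) * (inner (g l) ?u)\<^sup>2"
      using \<beta> \<kappa>(2) by (intro mult_left_mono) auto
    ultimately have "\<alpha>\<^sup>2 * ((1 - \<kappa>) * (\<beta>\<^sup>2 * (norm ?u)\<^sup>2))
        \<le> \<alpha>\<^sup>2 * (SUP k'\<in>\<Lambda>d. (inner (g k') ?u)\<^sup>2)"
      by (intro mult_left_mono) auto
    with j(2) have "\<alpha>'\<^sup>2 * \<beta>\<^sup>2 * (norm ?u)\<^sup>2 \<le> (inner (g j) ?u)\<^sup>2"
      using \<kappa>(2) by (simp add: \<alpha>' power_mult_distrib mult_ac)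
    moreover have "(norm (R (Suc m)))\<^sup>2 = (norm ?u)\<^sup>2 - (inner (g j) ?u)\<^sup>2"
      unfolding Suc using j(1) assms(18) unit by (intro norm_diff_projection) auto
    ultimately have "(norm (R (Suc m)))\<^sup>2 \<le> (1 - \<alpha>'\<^sup>2 * \<beta>\<^sup>2) * (norm ?u)\<^sup>2"
      by (simp add: algebra_simps)
    then have "sqrt ((norm (R (Suc m)))\<^sup>2) \<le> sqrt ((1 - \<alpha>'\<^sup>2 * \<beta>\<^sup>2) * (norm ?u)\<^sup>2)"
      by (rule real_sqrt_le_mono)
    then show ?thesis by (simp add: real_sqrt_mult)
  qed
  have in_S: "R m \<in> S" if f: "f \<in> S" and R: "mp_residuals g \<Lambda>d \<alpha> f R" for f R m
  proof (induction m)
    case 0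
    then show ?case using f R unfolding mp_residuals_def by simp
  next
    case (Suc m)
    obtain j where "j \<in> \<Lambda>d" "R (Suc m) = R m - inner (g j) (R m) *\<^sub>R g j"
      using R unfolding mp_residuals_def by blast
    moreover from this have "g j \<in> S" using assms(13,18) by blast
    ultimately show ?case
      using Suc assms(11) by (simp add: subspace_diff subspace_scale)
  qed
  have "norm (R m) \<le> sqrt (1 - \<alpha>'\<^sup>2 * \<beta>\<^sup>2) ^ m * norm f"
    if f: "f \<in> S" and R: "mp_residuals g \<Lambda>d \<alpha> f R" for f R m
  proof -
    have "0 \<le> sqrt (1 - \<alpha>'\<^sup>2 * \<beta>\<^sup>2)"
    proof -
      \<comment> \<open>This amounts to \<open>\<beta> \<le> 1\<close>, which follows by testing \<open>\<beta>\<close> with an atom in place of \<open>u\<close>.\<close>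
      obtain j where j: "j \<in> \<Lambda>"
        using assms(9) unfolding maximizers_exist_def by blast
      obtain l where l: "l \<in> \<Lambda>" "\<And>l'. l' \<in> \<Lambda> \<Longrightarrow> (inner (g l') (g j))\<^sup>2 \<le> (inner (g l) (g j))\<^sup>2"
        using assms(9) unfolding maximizers_exist_def by blast
      have "g j \<in> S" using j assms(13) by blast
      then have "\<beta>\<^sup>2 * (norm (g j))\<^sup>2 \<le> (inner (g l) (g j))\<^sup>2"
        unfolding assms(14)
        by (intro greedy_factor_le[OF assms(11)]) (use l unit assms(14,15) in auto)
      also have "\<dots> \<le> 1"
        using Cauchy_Schwarz_ineq2[of "g l" "g j"] unit[OF l(1)] unit[OF j] by (simp add: abs_square_le_1)
      finally have "\<beta>\<^sup>2 \<le> 1" using unit[OF j] by simp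
      moreover have "\<alpha>'\<^sup>2 \<le> 1"
        using \<open>0 < \<alpha>\<close> \<open>\<alpha> \<le> 1\<close> \<kappa>
        by (auto simp: \<alpha>' power_mult_distrib intro!: mult_le_one power_le_one)
      ultimately show ?thesis by (simp add: mult_le_one)
    qed
    then show ?thesis
    proof (induction m)
      case 0
      then show ?case using R unfolding mp_residuals_def by simp
    next
      case (Suc m)
      have "norm (R (Suc m)) \<le> sqrt (1 - \<alpha>'\<^sup>2 * \<beta>\<^sup>2) * norm (R m)"
        by (rule step[OF R in_S[OF f R]])
      also have "\<dots> \<le> sqrt (1 - \<alpha>'\<^sup>2 * \<beta>\<^sup>2) * (sqrt (1 - \<alpha>'\<^sup>2 * \<beta>\<^sup>2) ^ m * norm f)"
        using Suc by (intro mult_left_mono) auto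
      finally show ?case by simp
    qed
  qed
  moreover have "\<alpha>' \<le> \<alpha>"
    unfolding \<alpha>' using \<kappa> \<open>0 < \<alpha>\<close> by (simp add: mult_left_le)
  ultimately show ?thesis by blast
qed

end
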